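(* Let $R$ be a nonzero ring and let $G\neq 1$ be a locally finite group in which every finite subgroup has odd order. Then the group ring $RG$ is not strongly $\Delta$-clean.
   Context: Rings are associative with identity, not necessarily commutative. For a ring $S$, $U(S)$ is the group of units and $\Delta(S)=\{x\in S \mid 1-xu\in U(S)\text{ for all }u\in U(S)\}$. A ring $S$ is strongly $\Delta$-clean if every $a\in S$ can be written $a=e+d$ with $e^2=e\in S$, $d\in\Delta(S)$ and $ed=de$. A group is locally finite if every finitely generated subgroup is finite. *)

theory Defs
  imports "HOL-Algebra.Algebra"
begin

definition group_ring_supp :: "('a, 'm) ring_scheme \<Rightarrow> ('g, 'n) monoid_scheme \<Rightarrow> ('g \<Rightarrow> 'a) \<Rightarrow> 'g set"
  where "group_ring_supp R G f = {x \<in> carrier G. f x \<noteq> \<zero>\<^bsub>R\<^esub>}"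

text \<open>
  The formal sum of the \<open>a\<^sub>g g\<close> is represented by its finitely supported coefficient
  function \<open>g \<mapsto> a\<^sub>g\<close>, extended by \<open>undefined\<close> outside \<open>carrier G\<close> so that equality of
  elements is equality of functions. The coefficient of a product at \<open>g\<close> is the sum of the
  \<open>f x \<otimes> h y\<close> over all pairs with \<open>x \<otimes> y = g\<close>, where \<open>y\<close> is written as \<open>inv x \<otimes> g\<close>;
  restricting \<open>x\<close> to the support of \<open>f\<close> keeps the index set finite, as \<open>finsum\<close> is \<open>\<zero>\<close> on
  infinite sets.
\<close>

definition group_ring :: "('a, 'm) ring_scheme \<Rightarrow> ('g, 'n) monoid_scheme \<Rightarrow> ('g \<Rightarrow> 'a) ring"
  where "group_ring R G =
    \<lparr> carrier = {f \<in> carrier G \<rightarrow>\<^sub>E carrier R. finite (group_ring_supp R G f)},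
      monoid.mult = (\<lambda>f h. \<lambda>g\<in>carrier G.
        \<Oplus>\<^bsub>R\<^esub>x\<in>group_ring_supp R G f. f x \<otimes>\<^bsub>R\<^esub> h (inv\<^bsub>G\<^esub> x \<otimes>\<^bsub>G\<^esub> g)),
      one = (\<lambda>g\<in>carrier G. if g = \<one>\<^bsub>G\<^esub> then \<one>\<^bsub>R\<^esub> else \<zero>\<^bsub>R\<^esub>),
      ring.zero = (\<lambda>g\<in>carrier G. \<zero>\<^bsub>R\<^esub>),
      ring.add = (\<lambda>f h. \<lambda>g\<in>carrier G. f g \<oplus>\<^bsub>R\<^esub> h g) \<rparr>"

definition Delta :: "('a, 'm) ring_scheme \<Rightarrow> 'a set"
  where "Delta S = {x \<in> carrier S. \<forall>u \<in> Units S. \<one>\<^bsub>S\<^esub> \<ominus>\<^bsub>S\<^esub> x \<otimes>\<^bsub>S\<^esub> u \<in> Units S}"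

definition strongly_Delta_clean :: "('a, 'm) ring_scheme \<Rightarrow> bool"
  where "strongly_Delta_clean S \<longleftrightarrow>
    (\<forall>a \<in> carrier S. \<exists>e \<in> carrier S. \<exists>d \<in> Delta S.
       a = e \<oplus>\<^bsub>S\<^esub> d \<and> e \<otimes>\<^bsub>S\<^esub> e = e \<and> e \<otimes>\<^bsub>S\<^esub> d = d \<otimes>\<^bsub>S\<^esub> e)"

definition locally_finite :: "('g, 'n) monoid_scheme \<Rightarrow> bool"
  where "locally_finite G \<longleftrightarrow>
    (\<forall>A. A \<subseteq> carrier G \<and> finite A \<longrightarrow> finite (generate G A))"

lemma (in ring) finsum_swap:
  assumes "finite A" "finite B" "\<And>x y. x \<in> A \<Longrightarrow> y \<in> B \<Longrightarrow> f x y \<in> carrier R"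
  shows "(\<Oplus>x\<in>A. \<Oplus>y\<in>B. f x y) = (\<Oplus>y\<in>B. \<Oplus>x\<in>A. f x y)"
  using assms(1,3)
proof (induction A rule: finite_induct)
  case empty
  then show ?case by simp
next
  case (insert a A)
  have "(\<Oplus>x\<in>insert a A. \<Oplus>y\<in>B. f x y) = (\<Oplus>y\<in>B. f a y) \<oplus> (\<Oplus>x\<in>A. \<Oplus>y\<in>B. f x y)"
    using insert by (intro finsum_insert) auto
  also have "\<dots> = (\<Oplus>y\<in>B. f a y) \<oplus> (\<Oplus>y\<in>B. \<Oplus>x\<in>A. f x y)"
    using insert by simp
  also have "\<dots> = (\<Oplus>y\<in>B. f a y \<oplus> (\<Oplus>x\<in>A. f x y))"
    using insert by (intro finsum_addf[symmetric]) auto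
  also have "\<dots> = (\<Oplus>y\<in>B. \<Oplus>x\<in>insert a A. f x y)"
    using insert by (intro finsum_cong') (auto intro!: finsum_insert[symmetric])
  finally show ?case .
qed

locale group_ring_loc = R: ring R + G: group G for R (structure) and G (structure)
begin

abbreviation "RG \<equiv> group_ring R G"
abbreviation "supp \<equiv> group_ring_supp R G"

lemma carrD:
  assumes "f \<in> carrier RG"
  shows "f \<in> extensional (carrier G)" "\<And>x. x \<in> carrier G \<Longrightarrow> f x \<in> carrier R"
    "finite (supp f)" "supp f \<subseteq> carrier G"
  using assms by (auto simp: group_ring_def group_ring_supp_def PiE_def)

lemma carrI:
  assumes "f \<in> extensional (carrier G)" "\<And>x. x \<in> carrier G \<Longrightarrow> f x \<in> carrier R"
    "finite A" "\<And>x. x \<in> carrier G \<Longrightarrow> x \<notin> A \<Longrightarrow> f x = \<zero>\<^bsub>R\<^esub>"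
  shows "f \<in> carrier RG"
proof -
  have "supp f \<subseteq> A" using assms(4) by (auto simp: group_ring_supp_def)
  then have "finite (supp f)" using assms(3) finite_subset by blast
  then show ?thesis using assms(1,2) by (auto simp: group_ring_def PiE_def)
qed

lemma eqI:
  assumes "f \<in> extensional (carrier G)" "h \<in> extensional (carrier G)"
    "\<And>x. x \<in> carrier G \<Longrightarrow> f x = h x"
  shows "f = h"
  using assms by (rule extensionalityI)

lemma add_eq: "g \<in> carrier G \<Longrightarrow> (f \<oplus>\<^bsub>RG\<^esub> h) g = f g \<oplus>\<^bsub>R\<^esub> h g"
  and zero_eq: "g \<in> carrier G \<Longrightarrow> \<zero>\<^bsub>RG\<^esub> g = \<zero>\<^bsub>R\<^esub>"
  and one_eq: "g \<in> carrier G \<Longrightarrow> \<one>\<^bsub>RG\<^esub> g = (if g = \<one>\<^bsub>G\<^esub> then \<one>\<^bsub>R\<^esub> else \<zero>\<^bsub>R\<^esub>)"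
  and ext: "f \<oplus>\<^bsub>RG\<^esub> h \<in> extensional (carrier G)" "\<zero>\<^bsub>RG\<^esub> \<in> extensional (carrier G)"
     "\<one>\<^bsub>RG\<^esub> \<in> extensional (carrier G)" "f \<otimes>\<^bsub>RG\<^esub> h \<in> extensional (carrier G)"
  by (auto simp: group_ring_def)

lemma mult_eq:
  assumes "f \<in> carrier RG" "h \<in> carrier RG" "g \<in> carrier G"
    "finite A" "supp f \<subseteq> A" "A \<subseteq> carrier G"
  shows "(f \<otimes>\<^bsub>RG\<^esub> h) g = (\<Oplus>\<^bsub>R\<^esub>x\<in>A. f x \<otimes>\<^bsub>R\<^esub> h (inv\<^bsub>G\<^esub> x \<otimes>\<^bsub>G\<^esub> g))"
proof -
  have "(f \<otimes>\<^bsub>RG\<^esub> h) g = (\<Oplus>\<^bsub>R\<^esub>x\<in>supp f. f x \<otimes>\<^bsub>R\<^esub> h (inv\<^bsub>G\<^esub> x \<otimes>\<^bsub>G\<^esub> g))"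
    using assms(3) by (simp add: group_ring_def)
  also have "\<dots> = (\<Oplus>\<^bsub>R\<^esub>x\<in>A. f x \<otimes>\<^bsub>R\<^esub> h (inv\<^bsub>G\<^esub> x \<otimes>\<^bsub>G\<^esub> g))"
  proof (rule R.add.finprod_mono_neutral_cong_left)
    show "f i \<otimes>\<^bsub>R\<^esub> h (inv\<^bsub>G\<^esub> i \<otimes>\<^bsub>G\<^esub> g) = \<zero>\<^bsub>R\<^esub>" if "i \<in> A - supp f" for i
      using that assms carrD(2)[OF assms(2)] by (auto simp: group_ring_supp_def subset_iff)
  qed (use assms carrD(2)[OF assms(1)] carrD(2)[OF assms(2)] in \<open>auto simp: subset_iff\<close>)
  finally show ?thesis .
qed

lemma mult_closed:
  assumes f: "f \<in> carrier RG" and h: "h \<in> carrier RG"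
  shows "f \<otimes>\<^bsub>RG\<^esub> h \<in> carrier RG"
    "supp (f \<otimes>\<^bsub>RG\<^esub> h) \<subseteq> (\<lambda>(x, y). x \<otimes>\<^bsub>G\<^esub> y) ` (supp f \<times> supp h)"
proof -
  let ?A = "(\<lambda>(x, y). x \<otimes>\<^bsub>G\<^esub> y) ` (supp f \<times> supp h)"
  note F = carrD[OF f] and H = carrD[OF h]
  have z: "(f \<otimes>\<^bsub>RG\<^esub> h) g = \<zero>\<^bsub>R\<^esub>" if g: "g \<in> carrier G" "g \<notin> ?A" for g
  proof -
    have "f x \<otimes>\<^bsub>R\<^esub> h (inv\<^bsub>G\<^esub> x \<otimes>\<^bsub>G\<^esub> g) = \<zero>\<^bsub>R\<^esub>" if x: "x \<in> supp f" for x
    proof -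
      have xc: "x \<in> carrier G" using x F by blast
      have "g = x \<otimes>\<^bsub>G\<^esub> (inv\<^bsub>G\<^esub> x \<otimes>\<^bsub>G\<^esub> g)" using xc g by (simp add: G.m_assoc[symmetric])
      then have "inv\<^bsub>G\<^esub> x \<otimes>\<^bsub>G\<^esub> g \<notin> supp h" using x g by force
      then have "h (inv\<^bsub>G\<^esub> x \<otimes>\<^bsub>G\<^esub> g) = \<zero>\<^bsub>R\<^esub>" using xc g by (simp add: group_ring_supp_def)
      then show ?thesis using F xc by simp
    qed
    then show ?thesis using mult_eq[OF f h g(1) F(3) subset_refl F(4)]
      by (simp cong: R.finsum_cong)
  qed
  have c: "(f \<otimes>\<^bsub>RG\<^esub> h) g \<in> carrier R" if g: "g \<in> carrier G" for g
    using mult_eq[OF f h g F(3) subset_refl F(4)] F H g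
    by (auto intro!: R.finsum_closed simp: subset_iff)
  show "f \<otimes>\<^bsub>RG\<^esub> h \<in> carrier RG"
    using z c F(3) H(3) by (intro carrI[where A = ?A] ext) auto
  show "supp (f \<otimes>\<^bsub>RG\<^esub> h) \<subseteq> ?A"
    using z by (auto simp: group_ring_supp_def[of R G "f \<otimes>\<^bsub>RG\<^esub> h"])
qed

lemma mult_assoc:
  assumes f: "f \<in> carrier RG" and h: "h \<in> carrier RG" and k: "k \<in> carrier RG"
  shows "f \<otimes>\<^bsub>RG\<^esub> h \<otimes>\<^bsub>RG\<^esub> k = f \<otimes>\<^bsub>RG\<^esub> (h \<otimes>\<^bsub>RG\<^esub> k)"
proof (rule eqI)
  fix g assume g: "g \<in> carrier G"
  note F = carrD[OF f] and H = carrD[OF h] and K = carrD[OF k]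
  define A where "A = (\<lambda>(x, y). x \<otimes>\<^bsub>G\<^esub> y) ` (supp f \<times> supp h)"
  have A: "finite A" "A \<subseteq> carrier G" using F(3,4) H(3,4) by (auto simp: A_def)
  have fc: "x \<in> carrier G" if "x \<in> supp f" for x using that F(4) by blast
  have hc: "x \<in> carrier G" if "x \<in> supp h" for x using that H(4) by blast
  have ac: "x \<in> carrier G" if "x \<in> A" for x using that A by blast
  let ?t = "\<lambda>x y. f y \<otimes>\<^bsub>R\<^esub> (h (inv\<^bsub>G\<^esub> y \<otimes>\<^bsub>G\<^esub> x) \<otimes>\<^bsub>R\<^esub> k (inv\<^bsub>G\<^esub> x \<otimes>\<^bsub>G\<^esub> g))"
  have "(f \<otimes>\<^bsub>RG\<^esub> h \<otimes>\<^bsub>RG\<^esub> k) g =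
      (\<Oplus>\<^bsub>R\<^esub>x\<in>A. (f \<otimes>\<^bsub>RG\<^esub> h) x \<otimes>\<^bsub>R\<^esub> k (inv\<^bsub>G\<^esub> x \<otimes>\<^bsub>G\<^esub> g))"
    using mult_closed[OF f h] A by (intro mult_eq k g) (auto simp: A_def)
  also have "\<dots> = (\<Oplus>\<^bsub>R\<^esub>x\<in>A. \<Oplus>\<^bsub>R\<^esub>y\<in>supp f. ?t x y)"
  proof (rule R.finsum_cong')
    fix x assume x: "x \<in> A"
    have "(f \<otimes>\<^bsub>RG\<^esub> h) x \<otimes>\<^bsub>R\<^esub> k (inv\<^bsub>G\<^esub> x \<otimes>\<^bsub>G\<^esub> g) =
       (\<Oplus>\<^bsub>R\<^esub>y\<in>supp f. f y \<otimes>\<^bsub>R\<^esub> h (inv\<^bsub>G\<^esub> y \<otimes>\<^bsub>G\<^esub> x)) \<otimes>\<^bsub>R\<^esub> k (inv\<^bsub>G\<^esub> x \<otimes>\<^bsub>G\<^esub> g)"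
      using mult_eq[OF f h ac[OF x] F(3) subset_refl F(4)] by simp
    also have "\<dots> = (\<Oplus>\<^bsub>R\<^esub>y\<in>supp f. f y \<otimes>\<^bsub>R\<^esub> h (inv\<^bsub>G\<^esub> y \<otimes>\<^bsub>G\<^esub> x) \<otimes>\<^bsub>R\<^esub> k (inv\<^bsub>G\<^esub> x \<otimes>\<^bsub>G\<^esub> g))"
      using F(2,3) H(2) K(2) fc ac[OF x] g by (intro R.finsum_ldistr) auto
    also have "\<dots> = (\<Oplus>\<^bsub>R\<^esub>y\<in>supp f. ?t x y)"
      using F(2,3) H(2) K(2) fc ac[OF x] g by (intro R.finsum_cong') (auto simp: R.m_assoc)
    finally show "(f \<otimes>\<^bsub>RG\<^esub> h) x \<otimes>\<^bsub>R\<^esub> k (inv\<^bsub>G\<^esub> x \<otimes>\<^bsub>G\<^esub> g) = (\<Oplus>\<^bsub>R\<^esub>y\<in>supp f. ?t x y)" .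
  qed (use F(2) H(2) K(2) fc ac g in \<open>auto intro!: R.finsum_closed\<close>)
  also have "\<dots> = (\<Oplus>\<^bsub>R\<^esub>y\<in>supp f. \<Oplus>\<^bsub>R\<^esub>x\<in>A. ?t x y)"
    using F(2,3) H(2) K(2) fc ac g A by (intro R.finsum_swap) auto
  also have "\<dots> = (\<Oplus>\<^bsub>R\<^esub>y\<in>supp f. f y \<otimes>\<^bsub>R\<^esub> (h \<otimes>\<^bsub>RG\<^esub> k) (inv\<^bsub>G\<^esub> y \<otimes>\<^bsub>G\<^esub> g))"
  proof (rule R.finsum_cong')
    fix y assume y: "y \<in> supp f"
    note yc = fc[OF y]
    let ?B = "(\<lambda>z. y \<otimes>\<^bsub>G\<^esub> z) ` supp h"
    let ?u = "\<lambda>x. h (inv\<^bsub>G\<^esub> y \<otimes>\<^bsub>G\<^esub> x) \<otimes>\<^bsub>R\<^esub> k (inv\<^bsub>G\<^esub> x \<otimes>\<^bsub>G\<^esub> g)"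
    have canc: "inv\<^bsub>G\<^esub> y \<otimes>\<^bsub>G\<^esub> (y \<otimes>\<^bsub>G\<^esub> z) = z" "y \<otimes>\<^bsub>G\<^esub> (inv\<^bsub>G\<^esub> y \<otimes>\<^bsub>G\<^esub> z) = z"
      if "z \<in> carrier G" for z
      using that yc by (simp_all add: G.m_assoc[symmetric])
    have "(\<Oplus>\<^bsub>R\<^esub>x\<in>A. ?t x y) = f y \<otimes>\<^bsub>R\<^esub> (\<Oplus>\<^bsub>R\<^esub>x\<in>A. ?u x)"
      using F(2) H(2) K(2) yc ac g A by (intro R.finsum_rdistr[symmetric]) auto
    also have "(\<Oplus>\<^bsub>R\<^esub>x\<in>A. ?u x) = (\<Oplus>\<^bsub>R\<^esub>x\<in>?B. ?u x)"
    proof (rule R.add.finprod_mono_neutral_cong_right)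
      show "?B \<subseteq> A" using y by (auto simp: A_def)
      show "?u x = \<zero>\<^bsub>R\<^esub>" if x: "x \<in> A - ?B" for x
      proof -
        have "x \<in> carrier G" using x ac by blast
        then have "inv\<^bsub>G\<^esub> y \<otimes>\<^bsub>G\<^esub> x \<notin> supp h" using x canc(2) by force
        then have "h (inv\<^bsub>G\<^esub> y \<otimes>\<^bsub>G\<^esub> x) = \<zero>\<^bsub>R\<^esub>"
          using yc \<open>x \<in> carrier G\<close> by (simp add: group_ring_supp_def)
        then show "?u x = \<zero>\<^bsub>R\<^esub>" using K(2) \<open>x \<in> carrier G\<close> g by simp
      qed
    qed (use A H(2) K(2) yc ac g in auto)
    also have "\<dots> = (\<Oplus>\<^bsub>R\<^esub>z\<in>supp h. ?u (y \<otimes>\<^bsub>G\<^esub> z))"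
    proof (rule R.finsum_reindex)
      show "inj_on (\<lambda>z. y \<otimes>\<^bsub>G\<^esub> z) (supp h)"
        using canc(1) hc by (intro inj_onI) metis
    qed (use H(2) K(2) yc hc g in auto)
    also have "\<dots> = (\<Oplus>\<^bsub>R\<^esub>z\<in>supp h. h z \<otimes>\<^bsub>R\<^esub> k (inv\<^bsub>G\<^esub> z \<otimes>\<^bsub>G\<^esub> (inv\<^bsub>G\<^esub> y \<otimes>\<^bsub>G\<^esub> g)))"
      using H(2) K(2) yc hc g
      by (intro R.finsum_cong') (auto simp: canc G.inv_mult_group G.m_assoc)
    also have "\<dots> = (h \<otimes>\<^bsub>RG\<^esub> k) (inv\<^bsub>G\<^esub> y \<otimes>\<^bsub>G\<^esub> g)"
      using yc g by (intro mult_eq[symmetric] h k H) auto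
    finally show "(\<Oplus>\<^bsub>R\<^esub>x\<in>A. ?t x y) = f y \<otimes>\<^bsub>R\<^esub> (h \<otimes>\<^bsub>RG\<^esub> k) (inv\<^bsub>G\<^esub> y \<otimes>\<^bsub>G\<^esub> g)" .
  qed (use F(2) carrD(2)[OF mult_closed(1)[OF h k]] fc g in auto)
  also have "\<dots> = (f \<otimes>\<^bsub>RG\<^esub> (h \<otimes>\<^bsub>RG\<^esub> k)) g"
    by (intro mult_eq[symmetric] f mult_closed h k F g subset_refl)
  finally show "(f \<otimes>\<^bsub>RG\<^esub> h \<otimes>\<^bsub>RG\<^esub> k) g = (f \<otimes>\<^bsub>RG\<^esub> (h \<otimes>\<^bsub>RG\<^esub> k)) g" .
qed (rule ext)+

lemma add_closed:
  assumes f: "f \<in> carrier RG" and h: "h \<in> carrier RG"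
  shows "f \<oplus>\<^bsub>RG\<^esub> h \<in> carrier RG" "supp (f \<oplus>\<^bsub>RG\<^esub> h) \<subseteq> supp f \<union> supp h"
proof -
  have z: "(f \<oplus>\<^bsub>RG\<^esub> h) g = \<zero>\<^bsub>R\<^esub>" if "g \<in> carrier G" "g \<notin> supp f \<union> supp h" for g
    using that by (simp add: add_eq group_ring_supp_def)
  show "f \<oplus>\<^bsub>RG\<^esub> h \<in> carrier RG"
    using z carrD[OF f] carrD[OF h] by (intro carrI[where A = "supp f \<union> supp h"] ext) (auto simp: add_eq)
  show "supp (f \<oplus>\<^bsub>RG\<^esub> h) \<subseteq> supp f \<union> supp h"
    using z by (auto simp: group_ring_supp_def[of R G "f \<oplus>\<^bsub>RG\<^esub> h"])
qed

lemma zero_closed: "\<zero>\<^bsub>RG\<^esub> \<in> carrier RG"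
  by (intro carrI[where A = "{}"] ext) (auto simp: zero_eq)

lemma one_closed: "\<one>\<^bsub>RG\<^esub> \<in> carrier RG" and supp_one: "supp \<one>\<^bsub>RG\<^esub> \<subseteq> {\<one>\<^bsub>G\<^esub>}"
  by (intro carrI[where A = "{\<one>\<^bsub>G\<^esub>}"] ext) (auto simp: one_eq group_ring_supp_def split: if_splits)

lemma l_one:
  assumes f: "f \<in> carrier RG"
  shows "\<one>\<^bsub>RG\<^esub> \<otimes>\<^bsub>RG\<^esub> f = f"
proof (rule eqI)
  fix g assume g: "g \<in> carrier G"
  have "(\<one>\<^bsub>RG\<^esub> \<otimes>\<^bsub>RG\<^esub> f) g =
      (\<Oplus>\<^bsub>R\<^esub>x\<in>{\<one>\<^bsub>G\<^esub>}. \<one>\<^bsub>RG\<^esub> x \<otimes>\<^bsub>R\<^esub> f (inv\<^bsub>G\<^esub> x \<otimes>\<^bsub>G\<^esub> g))"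
    by (rule mult_eq[OF one_closed f g _ supp_one]) auto
  also have "\<dots> = f g" using g carrD(2)[OF f] by (simp add: one_eq)
  finally show "(\<one>\<^bsub>RG\<^esub> \<otimes>\<^bsub>RG\<^esub> f) g = f g" .
qed (auto intro: ext carrD[OF f])

lemma r_one:
  assumes f: "f \<in> carrier RG"
  shows "f \<otimes>\<^bsub>RG\<^esub> \<one>\<^bsub>RG\<^esub> = f"
proof (rule eqI)
  fix g assume g: "g \<in> carrier G"
  note F = carrD[OF f]
  let ?A = "insert g (supp f)"
  have A: "finite ?A" "?A \<subseteq> carrier G" using F g by auto
  have "(f \<otimes>\<^bsub>RG\<^esub> \<one>\<^bsub>RG\<^esub>) g =
      (\<Oplus>\<^bsub>R\<^esub>x\<in>?A. f x \<otimes>\<^bsub>R\<^esub> \<one>\<^bsub>RG\<^esub> (inv\<^bsub>G\<^esub> x \<otimes>\<^bsub>G\<^esub> g))"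
    by (rule mult_eq[OF f one_closed g A(1) _ A(2)]) auto
  also have "\<dots> = (\<Oplus>\<^bsub>R\<^esub>x\<in>?A. if x = g then f x else \<zero>\<^bsub>R\<^esub>)"
  proof (rule R.finsum_cong')
    fix x assume "x \<in> ?A"
    then have x: "x \<in> carrier G" using A by blast
    have "inv\<^bsub>G\<^esub> x \<otimes>\<^bsub>G\<^esub> g = \<one>\<^bsub>G\<^esub> \<longleftrightarrow> x = g"
      using x g by (metis G.inv_equality G.inv_inv G.inv_closed G.l_inv)
    then show "f x \<otimes>\<^bsub>R\<^esub> \<one>\<^bsub>RG\<^esub> (inv\<^bsub>G\<^esub> x \<otimes>\<^bsub>G\<^esub> g) = (if x = g then f x else \<zero>\<^bsub>R\<^esub>)"
      using x g F(2) by (simp add: one_eq)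
  qed (use A F(2) in auto)
  also have "\<dots> = f g"
    using A F(2) by (intro R.add.finprod_singleton_swap) auto
  finally show "(f \<otimes>\<^bsub>RG\<^esub> \<one>\<^bsub>RG\<^esub>) g = f g" .
qed (auto intro: ext carrD[OF f])

lemma l_distr:
  assumes f: "f \<in> carrier RG" and h: "h \<in> carrier RG" and k: "k \<in> carrier RG"
  shows "(f \<oplus>\<^bsub>RG\<^esub> h) \<otimes>\<^bsub>RG\<^esub> k = f \<otimes>\<^bsub>RG\<^esub> k \<oplus>\<^bsub>RG\<^esub> h \<otimes>\<^bsub>RG\<^esub> k"
proof (rule eqI)
  fix g assume g: "g \<in> carrier G"
  note F = carrD[OF f] and H = carrD[OF h] and K = carrD[OF k]
  let ?A = "supp f \<union> supp h"
  have A: "finite ?A" "?A \<subseteq> carrier G" using F H by auto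
  have ac: "x \<in> carrier G" if "x \<in> ?A" for x using that A by blast
  then have fc: "x \<in> supp f \<Longrightarrow> x \<in> carrier G" and hc: "x \<in> supp h \<Longrightarrow> x \<in> carrier G" for x by auto
  have "((f \<oplus>\<^bsub>RG\<^esub> h) \<otimes>\<^bsub>RG\<^esub> k) g =
      (\<Oplus>\<^bsub>R\<^esub>x\<in>?A. (f \<oplus>\<^bsub>RG\<^esub> h) x \<otimes>\<^bsub>R\<^esub> k (inv\<^bsub>G\<^esub> x \<otimes>\<^bsub>G\<^esub> g))"
    by (intro mult_eq add_closed f h k g A)
  also have "\<dots> = (\<Oplus>\<^bsub>R\<^esub>x\<in>?A. f x \<otimes>\<^bsub>R\<^esub> k (inv\<^bsub>G\<^esub> x \<otimes>\<^bsub>G\<^esub> g) \<oplus>\<^bsub>R\<^esub> h x \<otimes>\<^bsub>R\<^esub> k (inv\<^bsub>G\<^esub> x \<otimes>\<^bsub>G\<^esub> g))"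
    using F(2) H(2) K(2) fc hc g by (intro R.finsum_cong') (auto simp: add_eq R.l_distr)
  also have "\<dots> = (\<Oplus>\<^bsub>R\<^esub>x\<in>?A. f x \<otimes>\<^bsub>R\<^esub> k (inv\<^bsub>G\<^esub> x \<otimes>\<^bsub>G\<^esub> g)) \<oplus>\<^bsub>R\<^esub>
      (\<Oplus>\<^bsub>R\<^esub>x\<in>?A. h x \<otimes>\<^bsub>R\<^esub> k (inv\<^bsub>G\<^esub> x \<otimes>\<^bsub>G\<^esub> g))"
    using F(2) H(2) K(2) fc hc g by (intro R.finsum_addf) (auto)
  also have "\<dots> = (f \<otimes>\<^bsub>RG\<^esub> k \<oplus>\<^bsub>RG\<^esub> h \<otimes>\<^bsub>RG\<^esub> k) g"
    using mult_eq[OF f k g A(1) _ A(2)] mult_eq[OF h k g A(1) _ A(2)] g by (simp add: add_eq)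
  finally show "((f \<oplus>\<^bsub>RG\<^esub> h) \<otimes>\<^bsub>RG\<^esub> k) g = (f \<otimes>\<^bsub>RG\<^esub> k \<oplus>\<^bsub>RG\<^esub> h \<otimes>\<^bsub>RG\<^esub> k) g" .
qed (rule ext)+

lemma r_distr:
  assumes f: "f \<in> carrier RG" and h: "h \<in> carrier RG" and k: "k \<in> carrier RG"
  shows "k \<otimes>\<^bsub>RG\<^esub> (f \<oplus>\<^bsub>RG\<^esub> h) = k \<otimes>\<^bsub>RG\<^esub> f \<oplus>\<^bsub>RG\<^esub> k \<otimes>\<^bsub>RG\<^esub> h"
proof (rule eqI)
  fix g assume g: "g \<in> carrier G"
  note F = carrD[OF f] and H = carrD[OF h] and K = carrD[OF k]
  let ?A = "supp k"
  have A: "finite ?A" "?A \<subseteq> carrier G" using K by auto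
  have ac: "x \<in> carrier G" if "x \<in> ?A" for x using that A by blast
  have "(k \<otimes>\<^bsub>RG\<^esub> (f \<oplus>\<^bsub>RG\<^esub> h)) g =
      (\<Oplus>\<^bsub>R\<^esub>x\<in>?A. k x \<otimes>\<^bsub>R\<^esub> (f \<oplus>\<^bsub>RG\<^esub> h) (inv\<^bsub>G\<^esub> x \<otimes>\<^bsub>G\<^esub> g))"
    by (intro mult_eq add_closed f h k g A subset_refl)
  also have "\<dots> = (\<Oplus>\<^bsub>R\<^esub>x\<in>?A. k x \<otimes>\<^bsub>R\<^esub> f (inv\<^bsub>G\<^esub> x \<otimes>\<^bsub>G\<^esub> g) \<oplus>\<^bsub>R\<^esub> k x \<otimes>\<^bsub>R\<^esub> h (inv\<^bsub>G\<^esub> x \<otimes>\<^bsub>G\<^esub> g))"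
    using F(2) H(2) K(2) ac g by (intro R.finsum_cong') (auto simp: add_eq R.r_distr)
  also have "\<dots> = (\<Oplus>\<^bsub>R\<^esub>x\<in>?A. k x \<otimes>\<^bsub>R\<^esub> f (inv\<^bsub>G\<^esub> x \<otimes>\<^bsub>G\<^esub> g)) \<oplus>\<^bsub>R\<^esub>
      (\<Oplus>\<^bsub>R\<^esub>x\<in>?A. k x \<otimes>\<^bsub>R\<^esub> h (inv\<^bsub>G\<^esub> x \<otimes>\<^bsub>G\<^esub> g))"
    using F(2) H(2) K(2) ac g by (intro R.finsum_addf) auto
  also have "\<dots> = (k \<otimes>\<^bsub>RG\<^esub> f \<oplus>\<^bsub>RG\<^esub> k \<otimes>\<^bsub>RG\<^esub> h) g"
    using mult_eq[OF k f g A(1) _ A(2)] mult_eq[OF k h g A(1) _ A(2)] g by (simp add: add_eq)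
  finally show "(k \<otimes>\<^bsub>RG\<^esub> (f \<oplus>\<^bsub>RG\<^esub> h)) g = (k \<otimes>\<^bsub>RG\<^esub> f \<oplus>\<^bsub>RG\<^esub> k \<otimes>\<^bsub>RG\<^esub> h) g" .
qed (rule ext)+

lemma l_neg_ex:
  assumes f: "f \<in> carrier RG"
  shows "\<exists>h\<in>carrier RG. h \<oplus>\<^bsub>RG\<^esub> f = \<zero>\<^bsub>RG\<^esub>"
proof
  let ?h = "\<lambda>g\<in>carrier G. \<ominus>\<^bsub>R\<^esub> f g"
  note F = carrD[OF f]
  show "?h \<oplus>\<^bsub>RG\<^esub> f = \<zero>\<^bsub>RG\<^esub>"
    using F(2) by (intro eqI ext) (auto simp: add_eq zero_eq R.l_neg)
  show "?h \<in> carrier RG"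
    using F by (intro carrI[where A = "supp f"]) (auto simp: group_ring_supp_def)
qed

lemma ring_RG: "ring RG"
proof (rule ringI)
  show "abelian_group RG"
    by (rule abelian_groupI)
      (auto intro!: add_closed zero_closed l_neg_ex eqI ext
        simp: add_eq zero_eq R.a_ac carrD)
  show "monoid RG"
    by (rule monoidI) (auto intro: mult_closed one_closed mult_assoc l_one r_one)
qed (auto intro: l_distr r_distr)

end

lemma group_ring_is_ring:
  assumes "ring R" "group G"
  shows "ring (group_ring R G)"
  using assms by (intro group_ring_loc.ring_RG) (simp add: group_ring_loc_def)

end

(* A commuting decomposition v = e + d of a unit forces e to be a unit, so e = 1 and every unit
   lies in 1 + Delta. Consequently a sum of three, hence of any odd number of units is a unit.
   If g has odd order n, then 1 + g + ... + g^(n-1) is thus a unit annihilated by 1 - g, so g = 1: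
   strongly Delta-clean rings have no nontrivial units of odd order. *)
theory Submission
  imports Defs
begin

section \<open>Units of strongly Delta-clean rings\<close>

context ring
begin

lemma strongly_Delta_clean_unit_minus_one:
  assumes clean: "strongly_Delta_clean R" and v: "v \<in> Units R"
  shows "v \<ominus> \<one> \<in> Delta R"
proof -
  have vc: "v \<in> carrier R" and ivc: "inv v \<in> carrier R" using v by auto
  obtain e d where e: "e \<in> carrier R" "e \<otimes> e = e" and d: "d \<in> Delta R" and ved: "v = e \<oplus> d"
    using clean vc unfolding strongly_Delta_clean_def by blast
  have dc: "d \<in> carrier R" using d by (simp add: Delta_def)
  \<comment> \<open>Membership of \<open>d\<close> in Delta is tested at the unit
    \<open>inv v\<close>; multiplying by \<open>v\<close> on the right then yields
    \<open>v - d = e\<close>.\<close>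
  have "\<one> \<ominus> d \<otimes> inv v \<in> Units R"
    using d v by (auto simp: Delta_def)
  then have "(\<one> \<ominus> d \<otimes> inv v) \<otimes> v \<in> Units R" using v by blast
  moreover have "(\<one> \<ominus> d \<otimes> inv v) \<otimes> v = v \<ominus> d"
    using v vc ivc dc by (simp add: minus_eq l_distr l_minus m_assoc)
  moreover have "v \<ominus> d = e"
    using ved e dc by (simp add: minus_eq a_assoc r_neg)
  ultimately have "e \<in> Units R" by simp
  \<comment> \<open>The unit \<open>e\<close> cancels from \<open>e e = e 1\<close>.\<close>
  then have "e = \<one>" using e by (metis Units_l_cancel r_one one_closed)
  then have "v \<ominus> \<one> = d"
    using ved dc a_comm[of \<one> d] by (simp add: minus_eq a_assoc r_neg)
  then show ?thesis using d by simp
qed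

text \<open>The element \<open>d = -b a^-1 - 1\<close> lies in Delta because \<open>-b a^-1\<close>
  is a unit, and \<open>d a = -b - a\<close>. Testing \<open>d\<close> at the unit
  \<open>a c^-1\<close> makes \<open>(1 - d a c^-1) c = c - d a = a + b + c\<close> a unit.\<close>

lemma strongly_Delta_clean_add_three_units:
  assumes clean: "strongly_Delta_clean R"
    and a: "a \<in> Units R" and b: "b \<in> Units R" and c: "c \<in> Units R"
  shows "a \<oplus> b \<oplus> c \<in> Units R"
proof -
  have cl: "a \<in> carrier R" "b \<in> carrier R" "c \<in> carrier R" "inv a \<in> carrier R" "inv c \<in> carrier R"
    using a b c by auto
  define d where "d = \<ominus> b \<otimes> inv a \<ominus> \<one>"
  have "\<ominus> b \<in> Units R"
    using b by (metis Units_m_closed Units_minus_one_closed Units_closed l_minus l_one one_closed)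
  then have d: "d \<in> Delta R"
    unfolding d_def using a by (intro strongly_Delta_clean_unit_minus_one clean) auto
  have dc: "d \<in> carrier R" using d by (simp add: Delta_def)
  have da: "d \<otimes> a = \<ominus> b \<ominus> a"
    using cl a by (simp add: d_def minus_eq l_distr l_minus m_assoc)
  have "\<one> \<ominus> d \<otimes> (a \<otimes> inv c) \<in> Units R"
    using d a c by (auto simp: Delta_def)
  then have "(\<one> \<ominus> d \<otimes> (a \<otimes> inv c)) \<otimes> c \<in> Units R" using c by blast
  moreover have "(\<one> \<ominus> d \<otimes> (a \<otimes> inv c)) \<otimes> c = c \<ominus> d \<otimes> a"
    using cl c dc by (simp add: minus_eq l_distr l_minus m_assoc)
  moreover have "c \<ominus> d \<otimes> a = a \<oplus> b \<oplus> c"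
    using cl by (simp add: da minus_eq minus_add a_ac)
  ultimately show ?thesis by simp
qed

text \<open>The index set has the odd size \<open>2k + 1\<close>. The sum starts as the single unit
  1, and each increment of \<open>k\<close> adds two powers of \<open>g\<close>, so the three
  summands are these powers and the previous sum.\<close>

lemma strongly_Delta_clean_geometric_sum_unit:
  assumes clean: "strongly_Delta_clean R" and g: "g \<in> Units R"
  shows "(\<Oplus>i\<in>{..2 * k}. g [^] (i::nat)) \<in> Units R"
proof (induction k)
  case 0
  then show ?case by simp
next
  case (Suc k)
  have gc: "g \<in> carrier R" using g by auto
  have "(\<Oplus>i\<in>{..2 * Suc k}. g [^] (i::nat)) =
      g [^] Suc (Suc (2 * k)) \<oplus> (g [^] Suc (2 * k) \<oplus> (\<Oplus>i\<in>{..2 * k}. g [^] (i::nat)))"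
    using gc by (simp add: finsum_Suc del: nat_pow_Suc)
  also have "\<dots> = g [^] Suc (Suc (2 * k)) \<oplus> g [^] Suc (2 * k) \<oplus> (\<Oplus>i\<in>{..2 * k}. g [^] (i::nat))"
    using gc by (intro a_assoc[symmetric]) (auto intro!: finsum_closed)
  also have "\<dots> \<in> Units R"
    using g Suc.IH by (intro strongly_Delta_clean_add_three_units clean Units_pow_closed)
  finally show ?case .
qed

lemma one_minus_mult_geometric_sum:
  assumes g: "g \<in> carrier R"
  shows "(\<one> \<ominus> g) \<otimes> (\<Oplus>i\<in>{..n}. g [^] (i::nat)) = \<one> \<ominus> g [^] Suc n"
proof (induction n)
  case 0
  then show ?case using g by simp
next
  case (Suc n)
  have "(\<one> \<ominus> g) \<otimes> (\<Oplus>i\<in>{..Suc n}. g [^] (i::nat)) =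
      (\<one> \<ominus> g) \<otimes> g [^] Suc n \<oplus> (\<one> \<ominus> g) \<otimes> (\<Oplus>i\<in>{..n}. g [^] (i::nat))"
    using g by (simp add: finsum_Suc r_distr finsum_closed del: nat_pow_Suc)
  \<comment> \<open>The new power multiplies \<open>g\<close> from the right of
    \<open>1 - g\<close>, so \<open>nat_pow_Suc2\<close> is used to split off the factor
    \<open>g\<close> on the left.\<close>
  also have "\<dots> = (g [^] Suc n \<ominus> g [^] Suc (Suc n)) \<oplus> (\<one> \<ominus> g [^] Suc n)"
    using g Suc.IH nat_pow_Suc2[OF g, of "Suc n"]
    by (simp add: minus_eq l_distr l_minus del: nat_pow_Suc)
  also have "\<dots> = \<one> \<ominus> g [^] Suc (Suc n)"
    using g by (simp add: minus_eq a_ac r_neg r_neg1 r_neg2 del: nat_pow_Suc)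
  finally show ?case .
qed

lemma strongly_Delta_clean_odd_order_unit:
  assumes clean: "strongly_Delta_clean R" and g: "g \<in> Units R"
    and n: "odd n" "g [^] (n::nat) = \<one>"
  shows "g = \<one>"
proof -
  have gc: "g \<in> carrier R" using g by auto
  \<comment> \<open>With this \<open>k\<close>, the exponents \<open>{..2 * k}\<close> are exactly
    those below \<open>n\<close>.\<close>
  obtain k where k: "n = Suc (2 * k)" using n(1) by (auto elim: oddE)
  let ?s = "\<Oplus>i\<in>{..2 * k}. g [^] (i::nat)"
  have s: "?s \<in> Units R" by (rule strongly_Delta_clean_geometric_sum_unit[OF clean g])
  have "(\<one> \<ominus> g) \<otimes> ?s = \<zero>"
    using n(2) one_minus_mult_geometric_sum[OF gc, of "2 * k"] by (simp add: k r_neg minus_eq)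
  then have "(\<one> \<ominus> g) \<otimes> ?s \<otimes> inv ?s = \<zero>" using s by simp
  then have "\<one> \<ominus> g = \<zero>" using s gc by (simp add: m_assoc)
  then show ?thesis using gc by simp
qed

end

section \<open>The embedding of the group into the units of its group ring\<close>

context group_ring_loc
begin

text \<open>The copy of the group element \<open>g\<close> in \<open>RG\<close>, that is, the formal
  sum \<open>1 g\<close>.\<close>

definition basis :: "'c \<Rightarrow> 'c \<Rightarrow> 'a"
  where "basis g = (\<lambda>x\<in>carrier G. if x = g then \<one>\<^bsub>R\<^esub> else \<zero>\<^bsub>R\<^esub>)"

lemma basis_closed: "basis g \<in> carrier RG"
  by (intro carrI[where A = "{g}"]) (auto simp: basis_def)

lemma basis_one: "basis \<one>\<^bsub>G\<^esub> = \<one>\<^bsub>RG\<^esub>"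
  by (simp add: basis_def group_ring_def)

lemma basis_mult:
  assumes g: "g \<in> carrier G" and h: "h \<in> carrier G"
  shows "basis g \<otimes>\<^bsub>RG\<^esub> basis h = basis (g \<otimes>\<^bsub>G\<^esub> h)"
proof (rule eqI)
  fix x assume x: "x \<in> carrier G"
  \<comment> \<open>The set \<open>{g}\<close> only has to contain the support of
    \<open>basis g\<close>, so the case \<open>1 = 0\<close>, where the support is empty, is
    covered.\<close>
  have "(basis g \<otimes>\<^bsub>RG\<^esub> basis h) x =
      (\<Oplus>\<^bsub>R\<^esub>y\<in>{g}. basis g y \<otimes>\<^bsub>R\<^esub> basis h (inv\<^bsub>G\<^esub> y \<otimes>\<^bsub>G\<^esub> x))"
    using g by (intro mult_eq basis_closed x) (auto simp: basis_def group_ring_supp_def)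
  also have "\<dots> = basis h (inv\<^bsub>G\<^esub> g \<otimes>\<^bsub>G\<^esub> x)"
    using g x carrD(2)[OF basis_closed, of "inv\<^bsub>G\<^esub> g \<otimes>\<^bsub>G\<^esub> x" h] by (simp add: basis_def[of g])
  \<comment> \<open>Both sides test the same condition: \<open>g^-1 x = h\<close> iff
    \<open>x = g h\<close>.\<close>
  also have "\<dots> = basis (g \<otimes>\<^bsub>G\<^esub> h) x"
    using g h x by (auto simp: basis_def G.m_assoc[symmetric])
  finally show "(basis g \<otimes>\<^bsub>RG\<^esub> basis h) x = basis (g \<otimes>\<^bsub>G\<^esub> h) x" .
qed (auto simp: ext basis_def)

lemma basis_pow:
  assumes g: "g \<in> carrier G"
  shows "basis g [^]\<^bsub>RG\<^esub> (n::nat) = basis (g [^]\<^bsub>G\<^esub> n)"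
proof (induction n)
  case 0
  then show ?case by (simp add: basis_one)
next
  case (Suc n)
  then show ?case using g by (simp add: basis_mult)
qed

lemma basis_unit:
  assumes g: "g \<in> carrier G"
  shows "basis g \<in> Units RG"
  using g basis_mult[of "inv\<^bsub>G\<^esub> g" g] basis_mult[of g "inv\<^bsub>G\<^esub> g"] basis_closed
  by (auto simp: Units_def basis_one intro!: bexI[where x = "basis (inv\<^bsub>G\<^esub> g)"])

text \<open>Comparing coefficients at \<open>g\<close> gives 1 on the left, but 0 on the right
  unless \<open>g\<close> is the identity; \<open>1 \<noteq> 0\<close> tells them apart.\<close>

lemma basis_eq_one_iff:
  assumes "g \<in> carrier G" and "\<one>\<^bsub>R\<^esub> \<noteq> \<zero>\<^bsub>R\<^esub>"
  shows "basis g = \<one>\<^bsub>RG\<^esub> \<longleftrightarrow> g = \<one>\<^bsub>G\<^esub>"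
proof
  assume "basis g = \<one>\<^bsub>RG\<^esub>"
  then have "basis g g = \<one>\<^bsub>RG\<^esub> g" by simp
  then show "g = \<one>\<^bsub>G\<^esub>" using assms by (simp add: basis_def one_eq split: if_splits)
qed (simp add: basis_one)

end

theorem proposition5p6:
  fixes R :: "('a, 'm) ring_scheme" and G :: "('g, 'n) monoid_scheme"
  assumes "ring R" and "carrier R \<noteq> {\<zero>\<^bsub>R\<^esub>}"
    and "group G" and "carrier G \<noteq> {\<one>\<^bsub>G\<^esub>}"
    and "locally_finite G"
    and "\<And>H. subgroup H G \<Longrightarrow> finite H \<Longrightarrow> odd (card H)"
  shows "\<not> strongly_Delta_clean (group_ring R G)"
proof
  assume clean: "strongly_Delta_clean (group_ring R G)"
  interpret group_ring_loc R G using assms(1,3) by (simp add: group_ring_loc_def)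
  interpret RG: ring RG by (rule ring_RG)
  obtain g where g: "g \<in> carrier G" "g \<noteq> \<one>\<^bsub>G\<^esub>" using assms(4) G.one_closed by blast
  \<comment> \<open>Local finiteness with one generator makes the cyclic group of \<open>g\<close>
    finite; its cardinality, odd by hypothesis, is the order of \<open>g\<close>.\<close>
  let ?H = "generate G {g}"
  have "finite ?H" using assms(5) g by (simp add: locally_finite_def)
  moreover have "subgroup ?H G" using g by (intro G.generate_is_subgroup) simp
  ultimately have "odd (card ?H)" by (intro assms(6))
  then have "odd (G.ord g)" using G.generate_pow_card[OF g(1)] by simp
  moreover have "basis g [^]\<^bsub>RG\<^esub> G.ord g = \<one>\<^bsub>RG\<^esub>"
    unfolding basis_pow[OF g(1)] G.pow_ord_eq_1[OF g(1)] by (rule basis_one)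
  ultimately have "basis g = \<one>\<^bsub>RG\<^esub>"
    using RG.strongly_Delta_clean_odd_order_unit[OF clean basis_unit[OF g(1)]] by blast
  moreover have "\<one>\<^bsub>R\<^esub> \<noteq> \<zero>\<^bsub>R\<^esub>" using assms(2) R.carrier_one_zero by simp
  ultimately show False using g basis_eq_one_iff by blast
qed

end
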